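(* Let $(x_0, x_1)$ and $(y_0, y_1)$ be pairs of floating-point numbers, all in one of the formats binary16, bfloat16, binary32, binary64, or binary128, of precision $p$, and let $u := 2^{-p}$. Suppose $x_0 = \mathrm{RNE}(x_0 + x_1)$ and $y_0 = \mathrm{RNE}(y_0 + y_1)$. Let $(z_0,z_1)$ be the output of the following algorithm ($\mathsf{ddadd}$): $$(s_0,s_1) := \mathrm{TwoSum}(x_0,y_0),\quad (t_0,t_1) := \mathrm{TwoSum}(x_1,y_1),\quad c := s_1 \oplus t_0,$$ $$(v_0,v_1) := \mathrm{TwoSum}(s_0,c),\quad w := t_1 \oplus v_1,\quad (z_0,z_1) := \mathrm{TwoSum}(v_0,w).$$ Then $(z_0, z_1)$ approximates the exact sum $x_0+x_1+y_0+y_1$ with relative error bounded above by $(1+2u)\,2^{-(2p-2)}$; that is, whenever $x_0+x_1+y_0+y_1 \neq 0$, $$\frac{|(z_0+z_1)-(x_0+x_1+y_0+y_1)|}{|x_0+x_1+y_0+y_1|} \le (1+2u)\,2^{-(2p-2)}.$$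
   Context: Floating-point numbers are in base 2 with precision $p$ and exponent range $\{e_{\min},\dots,e_{\max}\}$. The formats are: binary16 ($p=11$, exponents $-14,\dots,15$), bfloat16 ($p=8$, $-126,\dots,127$), binary32 ($p=24$, $-126,\dots,127$), binary64 ($p=53$, $-1022,\dots,1023$), binary128 ($p=113$, $-16382,\dots,16383$). A floating-point number is either zero (positive and negative zero are identified) or normalized, i.e. of the form $(-1)^s (1.m_1m_2\dots m_{p-1})_2 \times 2^e$ with $s \in\{0,1\}$, bits $m_i\in\{0,1\}$ and $e_{\min}\le e\le e_{\max}$. Subnormal numbers, infinities and NaN are ignored: all inputs, intermediate values and outputs are assumed to be normalized or zero (in particular no overflow occurs). $\mathrm{RNE}(r)$ denotes the real number $r$ rounded to the nearest floating-point number, ties to even. $x\oplus y := \mathrm{RNE}(x+y)$, where $+$ is exact addition. $\mathrm{TwoSum}(x,y) := (s,e)$ with $s = x\oplus y$ and $e = (x+y)-(x\oplus y)$ exactly (this error is a floating-point number). *)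

theory Defs
  imports Complex_Main
begin

text \<open>
  Triples of precision, minimum exponent and maximum exponent:
  binary16, bfloat16, binary32, binary64, binary128.
\<close>

definition fp_formats :: "(nat \<times> int \<times> int) set" where
  "fp_formats =
     {(11, -14, 15), (8, -126, 127), (24, -126, 127), (53, -1022, 1023), (113, -16382, 16383)}"

definition normalized :: "nat \<Rightarrow> bool \<Rightarrow> (nat \<Rightarrow> bool) \<Rightarrow> int \<Rightarrow> real" where
  "normalized p s m e =
     (-1) ^ of_bool s * (1 + (\<Sum>i = 1..p - 1. of_bool (m i) / 2 ^ i)) * 2 powi e"

definition floats :: "nat \<Rightarrow> int set \<Rightarrow> real set" where
  "floats p E = {0} \<union> {normalized p s m e | s m e. e \<in> E}"

definition even_float :: "nat \<Rightarrow> real \<Rightarrow> bool" where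
  "even_float p v \<longleftrightarrow> v = 0 \<or> (\<exists>s m e. v = normalized p s m e \<and> \<not> m (p - 1))"

definition nearest_even :: "nat \<Rightarrow> int set \<Rightarrow> real \<Rightarrow> real \<Rightarrow> bool" where
  "nearest_even p E r v \<longleftrightarrow>
     v \<in> floats p E \<and>
     (\<forall>w \<in> floats p E. \<bar>r - v\<bar> \<le> \<bar>r - w\<bar>) \<and>
     ((\<exists>w \<in> floats p E. w \<noteq> v \<and> \<bar>r - w\<bar> = \<bar>r - v\<bar>) \<longrightarrow> even_float p v)"

text \<open>
  Rounding leaves the exponent unbounded, so that overflow and underflow are visible as results
  outside \<open>floats p {emin..emax}\<close>, instead of being clamped to the largest float or flushed to zero.
  A result inside that set is the rounding within that set, by \<open>RNE_in_format\<close> below.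
\<close>

definition RNE :: "nat \<Rightarrow> real \<Rightarrow> real" where
  "RNE p r = (THE v. nearest_even p UNIV r v)"

definition fp_add :: "nat \<Rightarrow> real \<Rightarrow> real \<Rightarrow> real" where
  "fp_add p x y = RNE p (x + y)"

definition TwoSum :: "nat \<Rightarrow> real \<Rightarrow> real \<Rightarrow> real \<times> real" where
  "TwoSum p x y = (fp_add p x y, (x + y) - fp_add p x y)"

lemma bits_of_nat:
  "k < 2 ^ q \<Longrightarrow>
     \<exists>m. (\<Sum>i = 1..q. of_bool (m i) * 2 ^ (q - i)) = (k::nat) \<and> (q \<ge> 1 \<longrightarrow> m q = odd k)"
proof (induction q arbitrary: k)
  case 0
  then show ?case by simp
next
  case (Suc q)
  then have "k div 2 < 2 ^ q" by auto
  from Suc.IH[OF this] obtain m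
    where m: "(\<Sum>i = 1..q. of_bool (m i) * 2 ^ (q - i)) = k div 2" by blast
  let ?m = "m(Suc q := odd k)"
  have "(\<Sum>i = 1..q. of_bool (?m i) * 2 ^ (Suc q - i)) = (\<Sum>i = 1..q. 2 * (of_bool (m i) * 2 ^ (q - i)) :: nat)"
    by (rule sum.cong) (auto simp: Suc_diff_le)
  also have "\<dots> = 2 * (k div 2)"
    by (simp only: m flip: sum_distrib_left)
  finally have "(\<Sum>i = 1..Suc q. of_bool (?m i) * 2 ^ (Suc q - i)) = 2 * (k div 2) + of_bool (odd k)"
    by simp
  also have "\<dots> = k"
    by (metis even_two_times_div_two odd_two_times_div_two_succ of_bool_eq add.right_neutral)
  finally show ?case by (intro exI[of _ ?m]) simp
qed

lemma nat_of_bits: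
  fixes m :: "nat \<Rightarrow> bool" and q :: nat
  defines "k \<equiv> (\<Sum>i = 1..q. of_bool (m i) * 2 ^ (q - i) :: nat)"
  shows "k < 2 ^ q" and "q \<ge> 1 \<Longrightarrow> odd k = m q"
proof -
  have "(\<Sum>i = 1..q. of_bool (m i) * 2 ^ (q - i) :: nat) < 2 ^ q \<and>
        (q \<ge> 1 \<longrightarrow> odd (\<Sum>i = 1..q. of_bool (m i) * 2 ^ (q - i) :: nat) = m q)"
  proof (induction q)
    case (Suc q)
    have "(\<Sum>i = 1..q. of_bool (m i) * 2 ^ (Suc q - i)) = (\<Sum>i = 1..q. 2 * (of_bool (m i) * 2 ^ (q - i)) :: nat)"
      by (rule sum.cong) (auto simp: Suc_diff_le)
    then have "(\<Sum>i = 1..Suc q. of_bool (m i) * 2 ^ (Suc q - i)) =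
        2 * (\<Sum>i = 1..q. of_bool (m i) * 2 ^ (q - i)) + (of_bool (m (Suc q)) :: nat)"
      by (simp add: sum_distrib_left del: sum_of_bool_mult_eq sum_mult_of_bool_eq)
    with Suc show ?case by auto
  qed simp
  then show "k < 2 ^ q" and "q \<ge> 1 \<Longrightarrow> odd k = m q"
    by (auto simp: k_def)
qed

lemma normalized_conv:
  "normalized p s m e = (-1) ^ of_bool s *
     real (2 ^ (p - 1) + (\<Sum>i = 1..p - 1. of_bool (m i) * 2 ^ (p - 1 - i))) * 2 powi (e - int (p - 1))"
proof -
  have "(\<Sum>i = 1..p - 1. of_bool (m i) * 2 ^ (p - 1 - i) :: real) =
        (\<Sum>i = 1..p - 1. 2 ^ (p - 1) * (of_bool (m i) / 2 ^ i))"
    by (rule sum.cong) (auto simp: power_diff)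
  also have "\<dots> = 2 ^ (p - 1) * (\<Sum>i = 1..p - 1. of_bool (m i) / 2 ^ i)"
    by (simp only: sum_distrib_left)
  finally have "real (2 ^ (p - 1) + (\<Sum>i = 1..p - 1. of_bool (m i) * 2 ^ (p - 1 - i))) =
        2 ^ (p - 1) * (1 + (\<Sum>i = 1..p - 1. of_bool (m i) / 2 ^ i))"
    by (simp add: algebra_simps del: sum_of_bool_mult_eq sum_mult_of_bool_eq)
  then show ?thesis
    by (simp add: normalized_def power_int_diff)
qed

text \<open>The same floats with an integral significand.\<close>

lemma normalizedE:
  obtains k :: nat where "2 ^ (p - 1) \<le> k" "k < 2 ^ (p - 1) + 2 ^ (p - 1)" "p \<ge> 2 \<Longrightarrow> odd k = m (p - 1)"
    "normalized p s m e = (-1) ^ of_bool s * real k * 2 powi (e - int (p - 1))"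
proof (rule that)
  let ?k = "2 ^ (p - 1) + (\<Sum>i = 1..p - 1. of_bool (m i) * 2 ^ (p - 1 - i)) :: nat"
  show "2 ^ (p - 1) \<le> ?k" by simp
  show "?k < 2 ^ (p - 1) + 2 ^ (p - 1)" using nat_of_bits(1)[of m "p - 1"] by simp
  show "odd ?k = m (p - 1)" if "p \<ge> 2"
    using nat_of_bits(2)[of "p - 1" m] that by simp
qed (rule normalized_conv)

lemma normalizedI:
  assumes "2 ^ (p - 1) \<le> k" "k < 2 ^ (p - 1) + 2 ^ (p - 1)"
  obtains m where "p \<ge> 2 \<Longrightarrow> m (p - 1) = odd k"
    "\<And>s e. (-1) ^ of_bool s * real k * 2 powi (e - int (p - 1)) = normalized p s m e"
proof -
  have "k - 2 ^ (p - 1) < 2 ^ (p - 1)" using assms by linarith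
  from bits_of_nat[OF this] obtain m where
    "(\<Sum>i = 1..p - 1. of_bool (m i) * 2 ^ (p - 1 - i)) = k - 2 ^ (p - 1)"
    and m: "p - 1 \<ge> 1 \<longrightarrow> m (p - 1) = odd (k - 2 ^ (p - 1))" by blast
  then have "k = 2 ^ (p - 1) + (\<Sum>i = 1..p - 1. of_bool (m i) * 2 ^ (p - 1 - i))"
    using assms by simp
  moreover have "m (p - 1) = odd k" if "p \<ge> 2" using m that assms by auto
  ultimately show thesis
    by (intro that[of m]) (simp_all only: normalized_conv)
qed

lemma uminus_normalized:
  "- normalized p s m e = normalized p (\<not> s) m e"
  by (cases s) (simp_all only: normalized_def of_bool_eq simp_thms power_0 power_one_right
      mult_minus_left mult_1_left minus_minus)

lemma uminus_floats: "- v \<in> floats p E \<longleftrightarrow> v \<in> floats p E"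
proof -
  have "- v \<in> floats p E" if "v \<in> floats p E" for v
    using that unfolding floats_def by (auto simp: uminus_normalized)
  from this[of v] this[of "- v"] show ?thesis by auto
qed

lemma uminus_even_float: "even_float p (- v) \<longleftrightarrow> even_float p v"
proof -
  have "even_float p (- v)" if "even_float p v" for v
    using that unfolding even_float_def by (metis uminus_normalized neg_equal_0_iff_equal)
  from this[of v] this[of "- v"] show ?thesis by auto
qed

lemma uminus_nearest_even: "nearest_even p E (- r) (- v) \<longleftrightarrow> nearest_even p E r v"
proof -
  have "nearest_even p E (- r) (- v)" if "nearest_even p E r v" for r v
  proof -
    have "\<bar>- r - - v\<bar> \<le> \<bar>- r - w\<bar>" if "w \<in> floats p E" for w
    proof -
      have "\<bar>r - v\<bar> \<le> \<bar>r - - w\<bar>"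
        using \<open>nearest_even p E r v\<close> that uminus_floats unfolding nearest_even_def by blast
      then show ?thesis by linarith
    qed
    moreover have "even_float p (- v)"
      if "w \<in> floats p E" "w \<noteq> - v" "\<bar>- r - w\<bar> = \<bar>- r - - v\<bar>" for w
    proof -
      have "- w \<in> floats p E" "- w \<noteq> v" "\<bar>r - - w\<bar> = \<bar>r - v\<bar>"
        using that uminus_floats by (blast, force, linarith)
      then show ?thesis
        using \<open>nearest_even p E r v\<close> uminus_even_float unfolding nearest_even_def by blast
    qed
    ultimately show ?thesis
      using that uminus_floats unfolding nearest_even_def by blast
  qed
  from this[of r v] this[of "- r" "- v"] show ?thesis by auto
qed

lemma normalized_bounds:
  "2 powi e \<le> normalized p False m e" "normalized p False m e < 2 powi (e + 1)"
proof -
  obtain k :: nat where k: "2 ^ (p - 1) \<le> k" "k < 2 ^ (p - 1) + 2 ^ (p - 1)"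
    and n: "normalized p False m e = (-1) ^ of_bool False * real k * 2 powi (e - int (p - 1))"
    by (rule normalizedE[of p m False e]) blast
  have k': "(2::real) ^ (p - 1) \<le> k" "k < (2::real) ^ (p - 1) * 2"
    using k[folded of_nat_le_iff[where 'a = real] of_nat_less_iff[where 'a = real]]
    by (simp_all only: of_nat_add of_nat_power of_nat_numeral mult_2_right)
  have "normalized p False m e = (real k / 2 ^ (p - 1)) * 2 powi e"
    by (simp add: n power_int_diff)
  moreover have "1 \<le> real k / 2 ^ (p - 1)" "real k / 2 ^ (p - 1) < 2"
    using k' by (simp_all add: divide_simps)
  moreover have "(0::real) < 2 powi e" by simp
  ultimately have "1 * 2 powi e \<le> normalized p False m e" "normalized p False m e < 2 * 2 powi e"
    by (simp_all only: mult_right_mono mult_strict_right_mono less_imp_le)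
  then show "2 powi e \<le> normalized p False m e" "normalized p False m e < 2 powi (e + 1)"
    by (simp_all add: power_int_add)
qed

lemma normalized_pos_iff: "normalized p s m e > 0 \<longleftrightarrow> \<not> s"
proof -
  have "normalized p False m e > 0"
    using normalized_bounds(1)[of e p m] zero_less_power_int[of "2::real" e] by linarith
  then show ?thesis
    using uminus_normalized[of p False m e] by (cases s) auto
qed

lemma pos_floatE:
  assumes "w \<in> floats p E" "w > 0"
  obtains m e where "e \<in> E" "w = normalized p False m e"
proof -
  obtain s m e where "e \<in> E" and w: "w = normalized p s m e"
    using assms by (auto simp: floats_def)
  moreover have "\<not> s"
    using assms(2) by (simp add: w normalized_pos_iff)
  ultimately show thesis using that by auto
qed

lemma even_float_grid:
  fixes e :: int
  assumes "p \<ge> 2" "2 ^ (p - 1) \<le> n" "n \<le> 2 ^ (p - 1) + 2 ^ (p - 1)"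
  defines "x \<equiv> real n * 2 powi (e - int (p - 1))"
  shows "x \<in> floats p UNIV" and "even_float p x \<longleftrightarrow> even n"
proof -
  have x1: "x \<in> floats p UNIV \<and> (even_float p x \<longleftrightarrow> even n)"
    if n: "2 ^ (p - 1) \<le> n" "n < 2 ^ (p - 1) + 2 ^ (p - 1)"
      and x: "x = real n * 2 powi (e - int (p - 1))" for n e x
  proof -
    obtain m where m: "m (p - 1) = odd n"
      and eq: "\<And>s e. (-1) ^ of_bool s * real n * 2 powi (e - int (p - 1)) = normalized p s m e"
      using normalizedI[OF n] assms(1) by metis
    have x': "x = normalized p False m e" using eq[of False e] x by simp
    have "x > 0" by (simp add: x' normalized_pos_iff)
    have "even n" if even: "even_float p x"
    proof -
      obtain s m' e' where e': "x = normalized p s m' e'" "\<not> m' (p - 1)"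
        using even \<open>x > 0\<close> unfolding even_float_def by blast
      have "\<not> s" using \<open>x > 0\<close> e'(1) by (simp add: normalized_pos_iff)
      obtain k :: nat where k: "odd k = m' (p - 1)"
        and xk: "normalized p s m' e' = (-1) ^ of_bool s * real k * 2 powi (e' - int (p - 1))"
        using assms(1) by (rule_tac normalizedE[of p m' s e']) blast
      have "(2::real) powi e < 2 powi (e' + 1)" "(2::real) powi e' < 2 powi (e + 1)"
        using normalized_bounds[where e = e and m = m and p = p]
          normalized_bounds[where e = e' and m = m' and p = p] e'(1) x' \<open>\<not> s\<close> by auto
      then have "e < e' + 1" "e' < e + 1"
        by (meson linorder_not_less one_le_numeral power_int_increasing)+
      then have "e' = e" by simp
      then have "real k = real n" using x xk e' \<open>\<not> s\<close> by simp
      then show ?thesis using k e' by simp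
    qed
    moreover have "even_float p x" if "even n"
      using x' m that unfolding even_float_def by blast
    moreover have "x \<in> floats p UNIV" using x' by (auto simp: floats_def)
    ultimately show ?thesis by blast
  qed
  have "x \<in> floats p UNIV \<and> (even_float p x \<longleftrightarrow> even n)"
  proof (cases "n = 2 ^ (p - 1) + 2 ^ (p - 1)")
    case True
    then have "x = real (2 ^ (p - 1)) * 2 powi ((e + 1) - int (p - 1))"
      by (simp add: x_def power_int_diff power_int_add)
    from x1[OF _ _ this] have "x \<in> floats p UNIV \<and> (even_float p x \<longleftrightarrow> even (2 ^ (p - 1) :: nat))"
      by simp
    then show ?thesis using True assms(1) by simp
  next
    case False
    then show ?thesis using x1[of n x e] assms by simp
  qed
  then show "x \<in> floats p UNIV" and "even_float p x \<longleftrightarrow> even n" by auto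
qed

lemma nearest_even_between:
  assumes "a \<in> floats p E" "b \<in> floats p E" "a \<le> r" "r < b"
    and gap: "\<And>w. w \<in> floats p E \<Longrightarrow> w \<le> a \<or> b \<le> w"
    and parity: "even_float p a \<noteq> even_float p b"
  shows "\<exists>!v. nearest_even p E r v"
proof -
  have ab: "v = a \<or> v = b" if "nearest_even p E r v" for v
  proof -
    have "v \<in> floats p E" "\<bar>r - v\<bar> \<le> \<bar>r - a\<bar>" "\<bar>r - v\<bar> \<le> \<bar>r - b\<bar>"
      using that assms(1,2) unfolding nearest_even_def by blast+
    then show ?thesis using gap[of v] assms(3,4) by linarith
  qed
  have a: "nearest_even p E r a" if "r - a < b - r \<or> r - a = b - r \<and> even_float p a"
    unfolding nearest_even_def
  proof (intro conjI ballI impI)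
    show "\<bar>r - a\<bar> \<le> \<bar>r - w\<bar>" if "w \<in> floats p E" for w
      using gap[OF that] \<open>r - a < b - r \<or> _\<close> assms(3,4) by linarith
    assume "\<exists>w \<in> floats p E. w \<noteq> a \<and> \<bar>r - w\<bar> = \<bar>r - a\<bar>"
    then show "even_float p a" using that gap assms(3,4) by fastforce
  qed (fact assms(1))
  have b: "nearest_even p E r b" if "b - r < r - a \<or> r - a = b - r \<and> even_float p b"
    unfolding nearest_even_def
  proof (intro conjI ballI impI)
    show "\<bar>r - b\<bar> \<le> \<bar>r - w\<bar>" if "w \<in> floats p E" for w
      using gap[OF that] \<open>b - r < r - a \<or> _\<close> assms(3,4) by linarith
    assume "\<exists>w \<in> floats p E. w \<noteq> b \<and> \<bar>r - w\<bar> = \<bar>r - b\<bar>"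
    then show "even_float p b" using that gap assms(3,4) by fastforce
  qed (fact assms(2))
  have not_both: "\<not> (nearest_even p E r a \<and> nearest_even p E r b)"
  proof
    assume *: "nearest_even p E r a \<and> nearest_even p E r b"
    then have "\<bar>r - a\<bar> = \<bar>r - b\<bar>"
      using assms(1,2) unfolding nearest_even_def by (meson order_antisym)
    then have "even_float p a" "even_float p b"
      using * assms(1-4) unfolding nearest_even_def by force+
    with parity show False by blast
  qed
  have "nearest_even p E r a \<or> nearest_even p E r b"
    using a b parity by linarith
  then show ?thesis using ab not_both by metis
qed

lemma nearest_even_ex1:
  assumes "p \<ge> 2"
  shows "\<exists>!v. nearest_even p UNIV r v"
proof -
  have pos: "\<exists>!v. nearest_even p UNIV r v" if "r > 0" for r
  proof -
    define e where "e = \<lfloor>log 2 r\<rfloor>"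
    define g :: real where "g = 2 powi (e - int (p - 1))"
    define N :: nat where "N = 2 ^ (p - 1)"
    define n where "n = nat \<lfloor>r / g\<rfloor>"
    have g: "g > 0" by (simp add: g_def)
    have Ng: "real N * g = 2 powi e" by (simp add: N_def g_def power_int_diff)
    have "of_int e \<le> log 2 r" "log 2 r < of_int (e + 1)" unfolding e_def by linarith+
    then have "2 powr of_int e \<le> r" "r < 2 powr of_int (e + 1)"
      using that by (simp_all only: le_log_iff log_less_iff one_less_numeral_iff semiring_norm)
    then have "2 powi e \<le> r" "r < 2 powi (e + 1)"
      using powr_real_of_int'[of 2 e] powr_real_of_int'[of 2 "e + 1"] by simp_all
    then have r: "real N * g \<le> r" "r < real (N + N) * g"
      using Ng by (simp_all add: power_int_add algebra_simps)
    have "r / g \<ge> 0" using that g by simp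
    then have n: "real n \<le> r / g" "r / g < real n + 1"
      unfolding n_def by linarith+
    have "real N \<le> r / g" "r / g < real (N + N)" using r g by (simp_all add: field_simps)
    then have "real N < real (n + 1)" "real n < real (N + N)" using n by simp_all
    then have nN: "N \<le> n" "n < N + N" unfolding of_nat_less_iff by simp_all
    have F: "real n * g \<in> floats p UNIV" "even_float p (real n * g) \<longleftrightarrow> even n"
      "real (n + 1) * g \<in> floats p UNIV" "even_float p (real (n + 1) * g) \<longleftrightarrow> even (n + 1)"
      using even_float_grid[OF assms, of n e] even_float_grid[OF assms, of "n + 1" e] nN
      unfolding N_def g_def by simp_all
    show ?thesis
    proof (rule nearest_even_between)
      show "real n * g \<le> r" "r < real (n + 1) * g" using n g by (simp_all add: field_simps)
      show "w \<le> real n * g \<or> real (n + 1) * g \<le> w" if w: "w \<in> floats p UNIV" for w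
      proof (cases "w > 0")
        case False
        then show ?thesis using g by (smt (verit) mult_nonneg_nonneg of_nat_0_le_iff)
      next
        case True
        then obtain m e' where w': "w = normalized p False m e'" using w pos_floatE by blast
        consider "e' + 1 \<le> e" | "e + 1 \<le> e'" | "e' = e" by linarith
        then show ?thesis
        proof cases
          case 1
          then have "(2::real) powi (e' + 1) \<le> 2 powi e" by (intro power_int_increasing) auto
          then have "w \<le> real N * g" using normalized_bounds(2)[of p m e'] w' Ng by linarith
          also have "\<dots> \<le> real n * g" using nN g by simp
          finally show ?thesis by simp
        next
          case 2
          then have "(2::real) powi (e + 1) \<le> 2 powi e'" by (intro power_int_increasing) auto
          then have "real (N + N) * g \<le> w"
            using normalized_bounds(1)[of e' p m] w' Ng by (simp add: power_int_add algebra_simps)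
          moreover have "real (n + 1) * g \<le> real (N + N) * g"
            using nN g by (intro mult_right_mono) (auto simp del: of_nat_add)
          ultimately show ?thesis by linarith
        next
          case 3
          obtain k :: nat where
            "normalized p False m e' = (-1) ^ of_bool False * real k * 2 powi (e' - int (p - 1))"
            by (rule normalizedE[of p m False e']) blast
          then have "w = real k * g" using w' 3 by (simp add: g_def)
          moreover have "k \<le> n \<or> n + 1 \<le> k" by linarith
          ultimately show ?thesis
            using g by (simp only: mult_le_cancel_right_pos of_nat_le_iff)
        qed
      qed
    qed (use F in simp_all)
  qed
  consider "r > 0" | "r = 0" | "r < 0" by linarith
  then show ?thesis
  proof cases
    case 2
    then show ?thesis
      by (intro ex1I[of _ 0]) (auto simp: nearest_even_def floats_def even_float_def)
  next
    case 3
    then have "\<exists>!v. nearest_even p UNIV (- r) v" using pos by simp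
    then show ?thesis by (metis uminus_nearest_even minus_minus)
  qed (rule pos)
qed

lemma nearest_even_RNE: "p \<ge> 2 \<Longrightarrow> nearest_even p UNIV r (RNE p r)"
  unfolding RNE_def by (rule theI') (rule nearest_even_ex1)

lemma RNE_in_format:
  assumes "p \<ge> 2" "RNE p r \<in> floats p E"
  shows "nearest_even p E r v \<longleftrightarrow> v = RNE p r"
proof
  have sub: "floats p E \<subseteq> floats p UNIV" by (auto simp: floats_def)
  note R = nearest_even_RNE[OF assms(1), of r]
  show "nearest_even p E r v" if "v = RNE p r"
    using R assms(2) sub that unfolding nearest_even_def by blast
  assume v: "nearest_even p E r v"
  then have "v \<in> floats p E" "\<bar>r - v\<bar> \<le> \<bar>r - RNE p r\<bar>"
    using assms(2) unfolding nearest_even_def by blast+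
  then have d: "\<bar>r - v\<bar> = \<bar>r - RNE p r\<bar>"
    using R sub unfolding nearest_even_def by force
  show "v = RNE p r"
  proof (rule ccontr)
    assume "v \<noteq> RNE p r"
    then have "even_float p v"
      using v d assms(2) unfolding nearest_even_def by metis
    then have "nearest_even p UNIV r v"
      using R d \<open>v \<in> floats p E\<close> sub unfolding nearest_even_def by auto
    then show False
      using R nearest_even_ex1[OF assms(1)] \<open>v \<noteq> RNE p r\<close> by blast
  qed
qed

end

theory Submission
  imports Defs
begin

text \<open>
  The computed pair satisfies \<open>z\<^sub>0 + z\<^sub>1 = v\<^sub>0 + w\<close>, so the only errors are the roundings of \<open>c\<close> and of \<open>w\<close>.
  By a Sterbenz argument \<open>a + b\<close> is a float whenever \<open>\<bar>a + b\<bar>\<close> exceeds neither \<open>\<bar>a\<bar>\<close> nor \<open>\<bar>b\<bar>\<close>. If this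
  applies to \<open>x\<^sub>0, y\<^sub>0\<close> then \<open>s\<^sub>1 = 0\<close> and \<open>c = t\<^sub>0\<close> is exact; either it applies to \<open>s\<^sub>0, t\<^sub>0\<close> too and
  \<open>w\<close> is exact, or \<open>\<bar>t\<^sub>0\<bar> \<le> 2 \<bar>s\<^sub>0 + t\<^sub>0\<bar>\<close> and relative error bounds suffice. Otherwise
  \<open>\<bar>x\<^sub>0 + y\<^sub>0\<bar>\<close> exceeds one of \<open>\<bar>x\<^sub>0\<bar>, \<bar>y\<^sub>0\<bar>\<close>; if \<open>K\<close> is the power of two with
  \<open>K \<le> \<bar>x\<^sub>0 + y\<^sub>0\<bar> < 2 K\<close>, this forces \<open>\<bar>x\<^sub>1\<bar> + \<bar>y\<^sub>1\<bar> \<le> 3 u K\<close>, and half-ulp bounds give the result.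
\<close>

section \<open>Floats as integer multiples of powers of two\<close>

text \<open>A short significand is doubled, and its exponent lowered, until it reaches
  \<open>2 ^ (p - 1)\<close>; the unbounded exponent range always permits this.\<close>

lemma int_mult_powi_in_floats:
  assumes "p \<ge> 2" "\<bar>n\<bar> \<le> 2 ^ p"
  shows "of_int n * 2 powi j \<in> floats p UNIV"
proof -
  have two_p: "(2::nat) ^ p = 2 ^ (p - 1) + 2 ^ (p - 1)"
    using assms(1) by (cases p) auto
  have nat: "real k * 2 powi j \<in> floats p UNIV" if "k \<le> 2 ^ p" for k :: nat and j
    using that
  proof (induction "2 ^ p - k" arbitrary: k j rule: less_induct)
    case less
    consider "k = 0" | "0 < k" "k < 2 ^ (p - 1)" | "2 ^ (p - 1) \<le> k" by linarith
    then show ?case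
    proof cases
      case 2
      then have "real (2 * k) * 2 powi (j - 1) \<in> floats p UNIV"
        by (intro less.hyps) (use two_p in linarith)+
      then show ?thesis by (simp add: power_int_diff)
    next
      case 3
      then show ?thesis
        using even_float_grid(1)[OF assms(1), of k "j + int (p - 1)"] less.prems two_p by simp
    qed (simp add: floats_def)
  qed
  have "nat \<bar>n\<bar> \<le> 2 ^ p" using assms(2) by (simp add: nat_le_iff)
  from nat[OF this, of j] have "real_of_int \<bar>n\<bar> * 2 powi j \<in> floats p UNIV" by simp
  then show ?thesis
    using uminus_floats[of "of_int n * 2 powi j"] by (cases "n \<ge> 0") auto
qed

lemma float_nonzeroE:
  assumes "p \<ge> 2" "v \<in> floats p UNIV" "v \<noteq> 0"
  obtains n j :: int where "v = of_int n * 2 powi j" "2 ^ (p - 1) \<le> \<bar>n\<bar>" "\<bar>n\<bar> < 2 ^ p"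
proof -
  obtain s m e where v: "v = normalized p s m e"
    using assms by (auto simp: floats_def)
  obtain k :: nat where k: "2 ^ (p - 1) \<le> k" "k < 2 ^ (p - 1) + 2 ^ (p - 1)"
    and n: "normalized p s m e = (-1) ^ of_bool s * real k * 2 powi (e - int (p - 1))"
    by (rule normalizedE[of p m s e]) blast
  have "int (2 ^ (p - 1)) \<le> int k" "int k < int (2 ^ (p - 1) + 2 ^ (p - 1))"
    using k by (simp_all only: of_nat_le_iff of_nat_less_iff)
  moreover have "(2::int) ^ p = 2 ^ (p - 1) + 2 ^ (p - 1)"
    using assms(1) by (cases p) auto
  moreover have "v = of_int (if s then - int k else int k) * 2 powi (e - int (p - 1))"
    by (simp add: v n)
  ultimately show thesis by (intro that) (assumption | simp)+
qed

text \<open>If the exponent \<open>i\<close> of \<open>b\<close> were below \<open>j\<close>, then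
  \<open>b\<close> would lie strictly below \<open>2 ^ p * 2 powi i\<close>, hence below the least
  magnitude that a full significand has at exponent \<open>j\<close>.\<close>

lemma float_multiple:
  fixes n j :: int
  assumes "p \<ge> 2" "b \<in> floats p UNIV" "2 ^ (p - 1) \<le> \<bar>n\<bar>" "\<bar>of_int n * 2 powi j\<bar> \<le> \<bar>b\<bar>"
  shows "\<exists>m::int. b = of_int m * 2 powi j"
proof -
  have n: "(2::real) ^ (p - 1) \<le> \<bar>of_int n\<bar>"
    using assms(3) by (metis of_int_abs of_int_le_iff of_int_numeral of_int_power)
  then have n0: "(n::int) \<noteq> 0" by (smt (verit) of_int_0 zero_less_power)
  then have "b \<noteq> 0" using assms(4) by auto
  then obtain m i where b: "b = of_int m * 2 powi i" "\<bar>m\<bar> < 2 ^ p"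
    using float_nonzeroE[OF assms(1,2) \<open>b \<noteq> 0\<close>] by blast
  have "j \<le> i"
  proof (rule ccontr)
    assume "\<not> j \<le> i"
    then have "(2::real) powi (i + 1) \<le> 2 powi j" by (intro power_int_increasing) auto
    have "\<bar>real_of_int m\<bar> < 2 ^ p"
      using b(2) by (metis of_int_abs of_int_less_iff of_int_numeral of_int_power)
    then have "\<bar>b\<bar> < 2 ^ p * 2 powi i" by (simp add: b abs_mult)
    also have "\<dots> = 2 ^ (p - 1) * 2 powi (i + 1)"
      using assms(1) by (cases p) (auto simp: power_int_add)
    also have "\<dots> \<le> \<bar>of_int n\<bar> * 2 powi j"
      using n \<open>(2::real) powi (i + 1) \<le> 2 powi j\<close> by (intro mult_mono) auto
    also have "\<dots> \<le> \<bar>b\<bar>" using assms(4) by (simp add: abs_mult)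
    finally show False by simp
  qed
  then obtain d where "i = j + int d" using zle_iff_zadd by blast
  then have "b = of_int (m * 2 ^ d) * 2 powi j" by (simp add: b power_int_add)
  then show ?thesis by blast
qed

text \<open>Both summands lie on the grid of the smaller one. So does their sum, and since it is no
  larger than that summand, its multiplier fits into \<open>p\<close> bits.\<close>

lemma sterbenz:
  assumes "p \<ge> 2" "a \<in> floats p UNIV" "b \<in> floats p UNIV" "\<bar>a + b\<bar> \<le> \<bar>a\<bar>" "\<bar>a + b\<bar> \<le> \<bar>b\<bar>"
  shows "a + b \<in> floats p UNIV"
proof -
  have *: "a + b \<in> floats p UNIV"
    if ab: "a \<in> floats p UNIV" "b \<in> floats p UNIV" "\<bar>a + b\<bar> \<le> \<bar>a\<bar>" "\<bar>a\<bar> \<le> \<bar>b\<bar>" for a b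
  proof (cases "a = 0")
    case False
    then obtain n j where a: "a = of_int n * 2 powi j" "2 ^ (p - 1) \<le> \<bar>n\<bar>" "\<bar>n\<bar> < 2 ^ p"
      using float_nonzeroE[OF assms(1) ab(1) False] by blast
    obtain m where "b = of_int m * 2 powi j"
      using float_multiple[OF assms(1) ab(2) a(2)] ab(4) a(1) by blast
    then have sum: "a + b = of_int (n + m) * 2 powi j" by (simp add: a algebra_simps)
    have "\<bar>real_of_int (n + m)\<bar> \<le> \<bar>real_of_int n\<bar>"
      using ab(3) unfolding sum unfolding a(1) abs_mult by simp
    then have "\<bar>n + m\<bar> \<le> \<bar>n\<bar>" by linarith
    then show ?thesis
      unfolding sum using a(3) by (intro int_mult_powi_in_floats assms(1)) simp
  qed (use ab in simp)
  show ?thesis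
    using *[of a b] *[of b a] assms by (cases "\<bar>a\<bar> \<le> \<bar>b\<bar>") (auto simp: add.commute)
qed

section \<open>Error bounds for a single rounding\<close>

lemma powi_bracket:
  assumes "(r::real) \<noteq> 0"
  obtains k :: int where "2 powi k \<le> \<bar>r\<bar>" "\<bar>r\<bar> < 2 powi (k + 1)"
proof -
  define k where "k = \<lfloor>log 2 \<bar>r\<bar>\<rfloor>"
  have "of_int k \<le> log 2 \<bar>r\<bar>" "log 2 \<bar>r\<bar> < of_int (k + 1)" unfolding k_def by linarith+
  then have "2 powr of_int k \<le> \<bar>r\<bar>" "\<bar>r\<bar> < 2 powr of_int (k + 1)"
    using assms by (simp_all add: le_log_iff log_less_iff)
  then show thesis
    using powr_real_of_int'[of 2 k] powr_real_of_int'[of 2 "k + 1"] by (intro that[of k]) simp_all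
qed

context
  fixes p :: nat
  assumes p: "p \<ge> 2"
begin

lemma RNE_in_floats: "RNE p r \<in> floats p UNIV"
  using nearest_even_RNE[OF p] unfolding nearest_even_def by blast

lemma RNE_nearest: "f \<in> floats p UNIV \<Longrightarrow> \<bar>r - RNE p r\<bar> \<le> \<bar>r - f\<bar>"
  using nearest_even_RNE[OF p] unfolding nearest_even_def by blast

lemma RNE_float: "r \<in> floats p UNIV \<Longrightarrow> RNE p r = r"
  using RNE_nearest[of r r] by simp

text \<open>Rounding never jumps over a float: \<open>f\<close> or \<open>- f\<close> would be
  closer to \<open>r\<close>.\<close>

lemma RNE_abs_le: "\<bar>r\<bar> \<le> f \<Longrightarrow> f \<in> floats p UNIV \<Longrightarrow> \<bar>RNE p r\<bar> \<le> f"
  using RNE_nearest[of f r] RNE_nearest[of "- f" r] uminus_floats[of f p UNIV] by linarith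

lemma RNE_abs_ge: "f \<le> \<bar>r\<bar> \<Longrightarrow> f \<in> floats p UNIV \<Longrightarrow> f \<le> \<bar>RNE p r\<bar>"
  using RNE_nearest[of f r] RNE_nearest[of "- f" r] uminus_floats[of f p UNIV] by linarith

lemma powi_in_floats: "2 powi k \<in> floats p UNIV"
  using int_mult_powi_in_floats[OF p, of 1 k] by simp

text \<open>All multiples of \<open>g = 2 powi (k - int p)\<close> up to \<open>2 powi k\<close> in
  magnitude are floats, so \<open>RNE\<close> does at least as well as rounding to this grid, whose
  error is at most \<open>g / 2\<close>.\<close>

lemma RNE_error_powi:
  assumes "\<bar>r\<bar> \<le> 2 powi k"
  shows "\<bar>r - RNE p r\<bar> \<le> 2 powi (- int p) * 2 powi k / 2"
proof -
  define g :: real where "g = 2 powi (k - int p)"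
  have g: "g > 0" "2 powi k = 2 ^ p * g"
    by (simp_all add: g_def power_int_diff)
  have "r / g \<le> of_int (2 ^ p)" "of_int (- (2 ^ p)) \<le> r / g"
    using assms g by (simp_all add: field_simps)
  from this[THEN round_mono] have "\<bar>round (r / g)\<bar> \<le> 2 ^ p"
    unfolding round_of_int by linarith
  then have "of_int (round (r / g)) * g \<in> floats p UNIV"
    unfolding g_def by (rule int_mult_powi_in_floats[OF p])
  then have "\<bar>r - RNE p r\<bar> \<le> \<bar>r - of_int (round (r / g)) * g\<bar>" by (rule RNE_nearest)
  also have "\<dots> = \<bar>of_int (round (r / g)) - r / g\<bar> * g"
    using g by (simp add: abs_mult_pos' field_simps flip: abs_minus_commute)
  also have "\<dots> \<le> 1 / 2 * g"
    using g by (intro mult_right_mono of_int_round_abs_le) auto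
  finally show ?thesis by (simp add: g_def power_int_diff power_int_minus field_simps)
qed

lemma RNE_error_relative:
  "\<bar>r - RNE p r\<bar> \<le> 2 powi (- int p) * \<bar>r\<bar>"
  "\<bar>r - RNE p r\<bar> \<le> 2 powi (- int p) * \<bar>RNE p r\<bar>"
proof -
  have "\<bar>r - RNE p r\<bar> \<le> 2 powi (- int p) * \<bar>r\<bar> \<and> \<bar>r - RNE p r\<bar> \<le> 2 powi (- int p) * \<bar>RNE p r\<bar>"
  proof (cases "r = 0")
    case True
    then show ?thesis using RNE_float[of 0] by (simp add: floats_def)
  next
    case False
    then obtain k where k: "2 powi k \<le> \<bar>r\<bar>" "\<bar>r\<bar> < 2 powi (k + 1)" by (rule powi_bracket)
    have "\<bar>r - RNE p r\<bar> \<le> 2 powi (- int p) * 2 powi k"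
      using RNE_error_powi[of r "k + 1"] k(2) by (simp add: power_int_add)
    moreover have "2 powi (- int p) * 2 powi k \<le> 2 powi (- int p) * \<bar>r\<bar>"
      "2 powi (- int p) * 2 powi k \<le> 2 powi (- int p) * \<bar>RNE p r\<bar>"
      using k(1) RNE_abs_ge[OF k(1) powi_in_floats] by (simp_all add: mult_left_mono)
    ultimately show ?thesis by linarith
  qed
  then show "\<bar>r - RNE p r\<bar> \<le> 2 powi (- int p) * \<bar>r\<bar>"
    and "\<bar>r - RNE p r\<bar> \<le> 2 powi (- int p) * \<bar>RNE p r\<bar>" by auto
qed

text \<open>Bounds a low part from its high part alone. The strict inequality matters: a result
  equal to \<open>2 powi k\<close> may come from the binade above, where the spacing
  doubles.\<close>

lemma RNE_error_result_powi:
  assumes "\<bar>RNE p r\<bar> < 2 powi k"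
  shows "\<bar>r - RNE p r\<bar> \<le> 2 powi (- int p) * 2 powi k / 2"
  using RNE_error_powi[of r k] RNE_abs_ge[OF _ powi_in_floats, of k r] assms by linarith

end

section \<open>Error of the algorithm in the two cases\<close>

text \<open>Here \<open>c\<close> is \<open>t\<^sub>0\<close>, so only the rounding of
  \<open>w\<close> can err. With \<open>Q\<close> the magnitude of
  \<open>s\<^sub>0 + t\<^sub>0\<close>, its argument is at most \<open>3 * u * Q\<close>, while the
  exact sum is at least \<open>(1 - 2 * u) * Q\<close>.\<close>

lemma ddadd_error_cancelling:
  fixes p :: nat
  defines "u \<equiv> 2 powi (- int p)"
  assumes p: "p \<ge> 3"
    and s0: "s\<^sub>0 \<in> floats p UNIV" and t0: "t\<^sub>0 = RNE p t" and t1: "t - t\<^sub>0 \<in> floats p UNIV"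
    and v0: "v\<^sub>0 = RNE p (s\<^sub>0 + t\<^sub>0)" and w: "w = RNE p ((t - t\<^sub>0) + (s\<^sub>0 + t\<^sub>0 - v\<^sub>0))"
  shows "\<bar>v\<^sub>0 + w - (s\<^sub>0 + t)\<bar> \<le> 4 * u ^ 2 * \<bar>s\<^sub>0 + t\<bar>"
proof (cases "s\<^sub>0 + t\<^sub>0 \<in> floats p UNIV")
  case True
  with p v0 have "v\<^sub>0 = s\<^sub>0 + t\<^sub>0" by (simp add: RNE_float)
  moreover from this p w t1 have "w = t - t\<^sub>0" by (simp add: RNE_float)
  ultimately show ?thesis by simp
next
  case False
  have p2: "p \<ge> 2" using p by simp
  have "(2::real) powi (- int p) \<le> 2 powi (- 3)"
    using p by (intro power_int_increasing) auto
  then have u: "0 < u" "u \<le> 1 / 8" by (simp_all add: u_def)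
  define Q where "Q = \<bar>s\<^sub>0 + t\<^sub>0\<bar>"
  have "t\<^sub>0 \<in> floats p UNIV" using RNE_in_floats[OF p2] t0 by simp
  with False s0 p2 have "\<bar>s\<^sub>0 + t\<^sub>0\<bar> > \<bar>s\<^sub>0\<bar> \<or> \<bar>s\<^sub>0 + t\<^sub>0\<bar> > \<bar>t\<^sub>0\<bar>"
    using sterbenz by (meson linorder_not_less)
  \<comment> \<open>If it is \<open>s\<^sub>0\<close> that is smaller than the sum, the triangle
    inequality gives the factor 2.\<close>
  then have t0_le: "\<bar>t\<^sub>0\<bar> \<le> 2 * Q"  unfolding Q_def by (smt (verit))
  have "\<bar>t - t\<^sub>0\<bar> \<le> u * \<bar>t\<^sub>0\<bar>"
    using RNE_error_relative(2)[OF p2, of t] t0 by (simp add: u_def)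
  also have "\<dots> \<le> u * (2 * Q)" using t0_le u by (intro mult_left_mono) auto
  finally have t1_le: "\<bar>t - t\<^sub>0\<bar> \<le> 2 * (u * Q)" by simp
  have v1_le: "\<bar>s\<^sub>0 + t\<^sub>0 - v\<^sub>0\<bar> \<le> u * Q"
    using RNE_error_relative(1)[OF p2, of "s\<^sub>0 + t\<^sub>0"] v0 by (simp add: u_def Q_def)
  have "\<bar>v\<^sub>0 + w - (s\<^sub>0 + t)\<bar> \<le> u * \<bar>(t - t\<^sub>0) + (s\<^sub>0 + t\<^sub>0 - v\<^sub>0)\<bar>"
    using RNE_error_relative(1)[OF p2, of "(t - t\<^sub>0) + (s\<^sub>0 + t\<^sub>0 - v\<^sub>0)"] w
    unfolding u_def by linarith
  also have "\<dots> \<le> u * (3 * (u * Q))"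
    using t1_le v1_le u by (intro mult_left_mono) linarith+
  \<comment> \<open>This amounts to \<open>3 <= 4 * (1 - 2 * u)\<close>, that is,
    \<open>u <= 1 / 8\<close>.\<close>
  also have "\<dots> \<le> 4 * u ^ 2 * (Q - 2 * (u * Q))"
  proof -
    have "u * (u * Q) * u \<le> u * (u * Q) * (1 / 8)"
      using u by (intro mult_left_mono) (auto simp: Q_def)
    then show ?thesis by (simp add: power2_eq_square algebra_simps)
  qed
  also have "\<dots> \<le> 4 * u ^ 2 * \<bar>s\<^sub>0 + t\<bar>"
    using t1_le by (intro mult_left_mono) (auto simp: Q_def)
  finally show ?thesis .
qed

text \<open>Here \<open>r\<close> and \<open>t\<close> stand for the exact sums of the high and of
  the low parts. Rounding \<open>c\<close> costs at most \<open>2 * u ^ 2 * K\<close>. Rounding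
  \<open>w\<close> costs half of that, or the same amount when \<open>s\<^sub>0 + c\<close> leaves
  the binade of \<open>K\<close>; but then the exact sum is larger as well.\<close>

lemma ddadd_error_generic:
  fixes p :: nat and k :: int
  defines "u \<equiv> 2 powi (- int p)" and "K \<equiv> 2 powi k"
  assumes p: "p \<ge> 4"
    and r: "K \<le> \<bar>r\<bar>" "\<bar>r\<bar> < 2 * K" and t_le: "\<bar>t\<bar> \<le> 3 * (u * K)"
    and s0: "s\<^sub>0 = RNE p r" and t0: "t\<^sub>0 = RNE p t" and c: "c = RNE p ((r - s\<^sub>0) + t\<^sub>0)"
    and v0: "v\<^sub>0 = RNE p (s\<^sub>0 + c)" and w: "w = RNE p ((t - t\<^sub>0) + (s\<^sub>0 + c - v\<^sub>0))"
  shows "\<bar>v\<^sub>0 + w - (r + t)\<bar> \<le> 4 * u ^ 2 * \<bar>r + t\<bar>"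
proof -
  have p2: "p \<ge> 2" using p by simp
  have "(2::real) powi (- int p) \<le> 2 powi (- 4)"
    using p by (intro power_int_increasing) auto
  then have u: "0 < u" "u \<le> 1 / 16" by (simp_all add: u_def)
  have K: "K > 0" by (simp add: K_def)
  \<comment> \<open>\<open>K\<close>, \<open>L\<close> and \<open>D\<close> are the scales of the
    high parts, of their rounding errors, and of the errors in rounding those.\<close>
  define L where "L = u * K"
  define D where "D = u * L"
  have LK: "0 < L" "16 * L \<le> K" and DL: "0 < D" "16 * D \<le> L"
    using u K by (simp_all add: L_def D_def)
  have pow: "2 powi (k + 1) = 2 * K" "2 powi (k + 2) = 4 * K"
    "2 powi (k + 1 - int p) = 2 * L" "2 powi (k + 2 - int p) = 4 * L"
    by (simp_all add: K_def L_def u_def power_int_add power_int_diff power_int_minus field_simps)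
  have err2K: "\<bar>a - RNE p a\<bar> \<le> L" if "\<bar>a\<bar> \<le> 2 * K" for a
    using RNE_error_powi[OF p2, of a "k + 1"] that unfolding pow by (simp add: u_def L_def mult_ac)
  have err4K: "\<bar>a - RNE p a\<bar> \<le> 2 * L" if "\<bar>a\<bar> \<le> 4 * K" for a
    using RNE_error_powi[OF p2, of a "k + 2"] that unfolding pow by (simp add: u_def L_def mult_ac)
  have err2L: "\<bar>a - RNE p a\<bar> \<le> D" if "\<bar>a\<bar> \<le> 2 * L" for a
    using RNE_error_powi[OF p2, of a "k + 1 - int p"] that unfolding pow by (simp add: u_def D_def mult_ac)
  have err4L: "\<bar>a - RNE p a\<bar> \<le> 2 * D" if "\<bar>a\<bar> \<le> 4 * L" for a
    using RNE_error_powi[OF p2, of a "k + 2 - int p"] that unfolding pow by (simp add: u_def D_def mult_ac)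
  \<comment> \<open>As these bounds are floats, they survive rounding. In particular
    \<open>t\<^sub>0\<close> stays within \<open>3 * L\<close>, which leaves room for
    \<open>r - s\<^sub>0\<close> below \<open>4 * L\<close>.\<close>
  have fl: "2 * K \<in> floats p UNIV" "4 * L \<in> floats p UNIV" "3 * L \<in> floats p UNIV"
    using powi_in_floats[OF p2, of "k + 1"] powi_in_floats[OF p2, of "k + 2 - int p"]
      int_mult_powi_in_floats[OF p2, of 3 "k - int p"] power_increasing[OF p2, of "2::int"]
    unfolding pow by (simp_all add: L_def K_def u_def power_int_diff power_int_minus field_simps)
  define \<epsilon>\<^sub>1 where "\<epsilon>\<^sub>1 = c - ((r - s\<^sub>0) + t\<^sub>0)"
  define \<epsilon>\<^sub>2 where "\<epsilon>\<^sub>2 = w - ((t - t\<^sub>0) + (s\<^sub>0 + c - v\<^sub>0))"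
  have err: "v\<^sub>0 + w - (r + t) = \<epsilon>\<^sub>1 + \<epsilon>\<^sub>2" by (simp add: \<epsilon>\<^sub>1_def \<epsilon>\<^sub>2_def)
  have s: "\<bar>s\<^sub>0\<bar> \<le> 2 * K" "\<bar>r - s\<^sub>0\<bar> \<le> L"
    using r RNE_abs_le[OF p2 _ fl(1), of r] err2K[of r] by (simp_all add: s0)
  have t: "\<bar>t\<^sub>0\<bar> \<le> 3 * L" "\<bar>t - t\<^sub>0\<bar> \<le> 2 * D"
    using t_le RNE_abs_le[OF p2 _ fl(3), of t] err4L[of t] LK by (simp_all add: t0 L_def)
  have "\<bar>(r - s\<^sub>0) + t\<^sub>0\<bar> \<le> 4 * L" using s t by linarith
  then have c': "\<bar>c\<bar> \<le> 4 * L" "\<bar>\<epsilon>\<^sub>1\<bar> \<le> 2 * D"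
    using RNE_abs_le[OF p2 _ fl(2)] err4L[of "(r - s\<^sub>0) + t\<^sub>0"]
    by (simp_all add: c \<epsilon>\<^sub>1_def abs_minus_commute)
  have rt: "\<bar>r + t\<bar> \<ge> K - 3 * L" using r(1) t_le by (simp add: L_def)
  have main: "\<bar>\<epsilon>\<^sub>1 + \<epsilon>\<^sub>2\<bar> * K \<le> 4 * D * \<bar>r + t\<bar>"
  proof (cases "\<bar>s\<^sub>0 + c\<bar> \<le> 2 * K")
    case True
    then have "\<bar>s\<^sub>0 + c - v\<^sub>0\<bar> \<le> L" using err2K v0 by simp
    then have "\<bar>\<epsilon>\<^sub>2\<bar> \<le> D"
      using err2L[of "(t - t\<^sub>0) + (s\<^sub>0 + c - v\<^sub>0)"] t(2) DL unfolding \<epsilon>\<^sub>2_def w by linarith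
    then have "\<bar>\<epsilon>\<^sub>1 + \<epsilon>\<^sub>2\<bar> \<le> 3 * D" using c' by linarith
    then have "\<bar>\<epsilon>\<^sub>1 + \<epsilon>\<^sub>2\<bar> * K \<le> 3 * D * K" using K by (intro mult_right_mono) auto
    also have "\<dots> = 4 * D * (3 / 4 * K)" by simp
    \<comment> \<open>The exact sum is at least \<open>K - 3 * L\<close>, hence at least
      \<open>13 / 16 * K\<close>.\<close>
    also have "\<dots> \<le> 4 * D * \<bar>r + t\<bar>"
      using rt LK DL by (intro mult_left_mono) linarith+
    finally show ?thesis .
  next
    case False
    have "\<bar>s\<^sub>0 + c\<bar> \<le> 4 * K" using s c' LK by linarith
    then have "\<bar>s\<^sub>0 + c - v\<^sub>0\<bar> \<le> 2 * L" using err4K v0 by simp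
    then have "\<bar>\<epsilon>\<^sub>2\<bar> \<le> 2 * D"
      using err4L[of "(t - t\<^sub>0) + (s\<^sub>0 + c - v\<^sub>0)"] t(2) DL unfolding \<epsilon>\<^sub>2_def w by linarith
    then have "\<bar>\<epsilon>\<^sub>1 + \<epsilon>\<^sub>2\<bar> \<le> 4 * D" using c' by linarith
    \<comment> \<open>The exact sum differs from \<open>s\<^sub>0 + c\<close>, which exceeds
      \<open>2 * K\<close> in magnitude, by at most \<open>4 * D\<close>.\<close>
    moreover have "K \<le> \<bar>r + t\<bar>"
      using False c'(2) t(2) DL LK unfolding \<epsilon>\<^sub>1_def by linarith
    ultimately show ?thesis using K by (intro mult_mono) auto
  qed
  also have "4 * D * \<bar>r + t\<bar> = 4 * u ^ 2 * \<bar>r + t\<bar> * K"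
    by (simp add: D_def L_def power2_eq_square)
  finally show ?thesis using K unfolding err by (simp only: mult_le_cancel_right_pos)
qed

theorem theorem1:
  fixes p :: nat and emin emax :: int
    and x\<^sub>0 x\<^sub>1 y\<^sub>0 y\<^sub>1 s\<^sub>0 s\<^sub>1 t\<^sub>0 t\<^sub>1 c v\<^sub>0 v\<^sub>1 w z\<^sub>0 z\<^sub>1 u :: real
  assumes format: "(p, emin, emax) \<in> fp_formats"
    and u: "u = 2 powi (- int p)"
    and x: "x\<^sub>0 = RNE p (x\<^sub>0 + x\<^sub>1)"
    and y: "y\<^sub>0 = RNE p (y\<^sub>0 + y\<^sub>1)"
    and s: "(s\<^sub>0, s\<^sub>1) = TwoSum p x\<^sub>0 y\<^sub>0"
    and t: "(t\<^sub>0, t\<^sub>1) = TwoSum p x\<^sub>1 y\<^sub>1"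
    and c: "c = fp_add p s\<^sub>1 t\<^sub>0"
    and v: "(v\<^sub>0, v\<^sub>1) = TwoSum p s\<^sub>0 c"
    and w: "w = fp_add p t\<^sub>1 v\<^sub>1"
    and z: "(z\<^sub>0, z\<^sub>1) = TwoSum p v\<^sub>0 w"
    and inputs: "{x\<^sub>0, x\<^sub>1, y\<^sub>0, y\<^sub>1} \<subseteq> floats p {emin..emax}"
    and intermediates: "{s\<^sub>0, s\<^sub>1, t\<^sub>0, t\<^sub>1, c, v\<^sub>0, v\<^sub>1, w} \<subseteq> floats p {emin..emax}"
    and outputs: "{z\<^sub>0, z\<^sub>1} \<subseteq> floats p {emin..emax}"
    and nonzero: "x\<^sub>0 + x\<^sub>1 + y\<^sub>0 + y\<^sub>1 \<noteq> 0"
  shows "\<bar>(z\<^sub>0 + z\<^sub>1) - (x\<^sub>0 + x\<^sub>1 + y\<^sub>0 + y\<^sub>1)\<bar> / \<bar>x\<^sub>0 + x\<^sub>1 + y\<^sub>0 + y\<^sub>1\<bar>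
           \<le> (1 + 2 * u) * 2 powi (- (2 * int p - 2))"
proof -
  have p: "p \<ge> 8" using format by (auto simp: fp_formats_def)
  then have p2: "p \<ge> 2" by simp
  have sub: "a \<in> floats p {emin..emax} \<Longrightarrow> a \<in> floats p UNIV" for a
    by (auto simp: floats_def)
  have t1: "t\<^sub>1 \<in> floats p UNIV" using intermediates sub by simp
  have defs: "s\<^sub>0 = RNE p (x\<^sub>0 + y\<^sub>0)" "s\<^sub>1 = x\<^sub>0 + y\<^sub>0 - s\<^sub>0" "t\<^sub>0 = RNE p (x\<^sub>1 + y\<^sub>1)" "t\<^sub>1 = x\<^sub>1 + y\<^sub>1 - t\<^sub>0"
    "c = RNE p (s\<^sub>1 + t\<^sub>0)" "v\<^sub>0 = RNE p (s\<^sub>0 + c)" "v\<^sub>1 = s\<^sub>0 + c - v\<^sub>0" "w = RNE p (t\<^sub>1 + v\<^sub>1)"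
    and z_sum: "z\<^sub>0 + z\<^sub>1 = v\<^sub>0 + w"
    using s t c v w z by (simp_all add: TwoSum_def fp_add_def)
  have xy: "x\<^sub>0 \<in> floats p UNIV" "y\<^sub>0 \<in> floats p UNIV"
    using RNE_in_floats[OF p2] x y by metis+
  define S where "S = (x\<^sub>0 + y\<^sub>0) + (x\<^sub>1 + y\<^sub>1)"
  have "\<bar>v\<^sub>0 + w - S\<bar> \<le> 4 * u ^ 2 * \<bar>S\<bar>"
  proof (cases "\<bar>x\<^sub>0 + y\<^sub>0\<bar> \<le> \<bar>x\<^sub>0\<bar> \<and> \<bar>x\<^sub>0 + y\<^sub>0\<bar> \<le> \<bar>y\<^sub>0\<bar>")
    case True
    then have exact: "x\<^sub>0 + y\<^sub>0 \<in> floats p UNIV" using sterbenz[OF p2 xy] by blast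
    then have "s\<^sub>0 = x\<^sub>0 + y\<^sub>0" by (simp add: defs(1) RNE_float[OF p2])
    moreover from this have "c = t\<^sub>0"
      using RNE_float[OF p2 RNE_in_floats[OF p2]] by (simp add: defs)
    ultimately show ?thesis
      using ddadd_error_cancelling[of p s\<^sub>0 t\<^sub>0 "x\<^sub>1 + y\<^sub>1" v\<^sub>0 w] p exact t1 defs
      unfolding S_def u by simp
  next
    case False
    then have "x\<^sub>0 + y\<^sub>0 \<noteq> 0" by auto
    then obtain k where k: "2 powi k \<le> \<bar>x\<^sub>0 + y\<^sub>0\<bar>" "\<bar>x\<^sub>0 + y\<^sub>0\<bar> < 2 powi (k + 1)"
      by (rule powi_bracket)
    have pow: "(2::real) powi (k + 1) = 2 * 2 powi k" "(2::real) powi (k + 2) = 4 * 2 powi k"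
      by (simp_all add: power_int_add)
    \<comment> \<open>A low part is exactly the error of rounding the pair's sum to its high
      part.\<close>
    have err: "\<bar>b\<bar> \<le> u * 2 powi j / 2" if "a = RNE p (a + b)" "\<bar>a\<bar> < 2 powi j" for a b j
      using RNE_error_result_powi[OF p2, of "a + b" j] that unfolding u by simp
    \<comment> \<open>With \<open>K = 2 powi k\<close>, one high part is below \<open>2 * K\<close>
      and so, by the triangle inequality, the other is below \<open>4 * K\<close>. The low parts are
      then at most \<open>u * K\<close> and \<open>2 * u * K\<close>.\<close>
    have t_le: "\<bar>x\<^sub>1 + y\<^sub>1\<bar> \<le> 3 * (u * 2 powi k)"
    proof (cases "\<bar>x\<^sub>0 + y\<^sub>0\<bar> \<le> \<bar>x\<^sub>0\<bar>")
      case True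
      with False have "\<bar>y\<^sub>0\<bar> < 2 powi (k + 1)" "\<bar>x\<^sub>0\<bar> < 2 powi (k + 2)"
        using k unfolding pow by linarith+
      from err[OF y this(1)] err[OF x this(2)] show ?thesis unfolding pow by simp
    next
      case False
      then have "\<bar>x\<^sub>0\<bar> < 2 powi (k + 1)" "\<bar>y\<^sub>0\<bar> < 2 powi (k + 2)"
        using k unfolding pow by linarith+
      from err[OF x this(1)] err[OF y this(2)] show ?thesis unfolding pow by simp
    qed
    show ?thesis
      using ddadd_error_generic[of p k "x\<^sub>0 + y\<^sub>0" "x\<^sub>1 + y\<^sub>1" s\<^sub>0 t\<^sub>0 c v\<^sub>0 w] p k t_le defs
      unfolding S_def u pow by simp
  qed
  moreover have S: "x\<^sub>0 + x\<^sub>1 + y\<^sub>0 + y\<^sub>1 = S" by (simp add: S_def)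
  ultimately have "\<bar>(z\<^sub>0 + z\<^sub>1) - S\<bar> / \<bar>S\<bar> \<le> 4 * u ^ 2"
    using nonzero by (simp add: z_sum divide_le_eq)
  also have "4 * u ^ 2 = 2 powi (- (2 * int p - 2))"
  proof -
    have "(2::real) powi (- (2 * int p - 2)) = 2 powi (2 + (- int p) * 2)" by (simp add: algebra_simps)
    also have "\<dots> = 2 powi 2 * (2 powi (- int p)) powi 2"
      by (subst power_int_add) (simp_all only: power_int_mult, simp)
    finally show ?thesis by (simp add: u)
  qed
  \<comment> \<open>The argument yields \<open>4 * u ^ 2\<close> itself; the factor
    \<open>1 + 2 * u\<close> only enlarges it.\<close>
  also have "\<dots> \<le> (1 + 2 * u) * 2 powi (- (2 * int p - 2))"
    by (simp add: u)
  finally show ?thesis unfolding S .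
qed

end
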